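(* For every integer $n \ge 2$, the large rank of the semigroup ${\rm End}(B_n)$ is $r_5({\rm End}(B_n)) = n!+n+1$.
   Context: For an integer $n \ge 1$ let $[n] = \{1,\ldots,n\}$. The Brandt semigroup $(B_n,+)$ has underlying set $B_n = ([n]\times[n]) \cup \{\vartheta\}$, with operation $(i,j)+(k,l) = (i,l)$ if $j=k$ and $(i,j)+(k,l)=\vartheta$ if $j\neq k$, and $\alpha+\vartheta=\vartheta+\alpha=\vartheta$ for all $\alpha\in B_n$. ${\rm End}(B_n)$ is the semigroup, under composition of mappings, of all semigroup endomorphisms of $(B_n,+)$, i.e. all maps $f: B_n\to B_n$ with $(\alpha+\beta)f = \alpha f+\beta f$; maps are written on the right, so $fg$ means first $f$, then $g$. For a finite semigroup $\Gamma$, the large rank is $r_5(\Gamma)=\min\{k : \text{every subset } U \text{ of cardinality } k \text{ in } \Gamma \text{ generates } \Gamma\}$, where "$U$ generates $\Gamma$" means that the subsemigroup $\langle U\rangle$ generated by $U$ equals $\Gamma$. *)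

theory Defs
  imports "HOL-Library.FuncSet"
begin

definition subsemigroup :: "'a set \<Rightarrow> ('a \<Rightarrow> 'a \<Rightarrow> 'a) \<Rightarrow> 'a set \<Rightarrow> bool" where
  "subsemigroup S m T \<longleftrightarrow> T \<subseteq> S \<and> (\<forall>x\<in>T. \<forall>y\<in>T. m x y \<in> T)"

definition subsemigroup_generated :: "'a set \<Rightarrow> ('a \<Rightarrow> 'a \<Rightarrow> 'a) \<Rightarrow> 'a set \<Rightarrow> 'a set" where
  "subsemigroup_generated S m U = \<Inter> {T. subsemigroup S m T \<and> U \<subseteq> T}"

text \<open>Intended for a finite semigroup with carrier \<open>S\<close> and operation \<open>m\<close>. The minimum is then
  attained: \<open>k = card S\<close> qualifies, since its only subset of that size is \<open>S\<close> itself.\<close>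

definition large_rank :: "'a set \<Rightarrow> ('a \<Rightarrow> 'a \<Rightarrow> 'a) \<Rightarrow> nat" where
  "large_rank S m =
    (LEAST k. \<forall>U. U \<subseteq> S \<and> finite U \<and> card U = k \<longrightarrow> subsemigroup_generated S m U = S)"

datatype brandt_elt = Elt nat nat | Theta

fun brandt_add :: "brandt_elt \<Rightarrow> brandt_elt \<Rightarrow> brandt_elt" where
  "brandt_add (Elt i j) (Elt k l) = (if j = k then Elt i l else Theta)"
| "brandt_add Theta \<beta> = Theta"
| "brandt_add \<alpha> Theta = Theta"

definition brandt :: "nat \<Rightarrow> brandt_elt set" where
  "brandt n = {Elt i j |i j. i \<in> {1..n} \<and> j \<in> {1..n}} \<union> {Theta}"

text \<open>Self-maps of \<open>brandt n\<close> are represented by extensional functions (\<open>undefined\<close> outside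
  \<open>brandt n\<close>), so that each endomorphism is represented by exactly one HOL function.\<close>

definition brandt_End :: "nat \<Rightarrow> (brandt_elt \<Rightarrow> brandt_elt) set" where
  "brandt_End n = {f \<in> brandt n \<rightarrow>\<^sub>E brandt n.
     \<forall>\<alpha>\<in>brandt n. \<forall>\<beta>\<in>brandt n. f (brandt_add \<alpha> \<beta>) = brandt_add (f \<alpha>) (f \<beta>)}"

text \<open>Maps are written on the right: the product \<open>fg\<close> applies \<open>f\<close> first and then \<open>g\<close>.\<close>

definition brandt_End_mult ::
    "nat \<Rightarrow> (brandt_elt \<Rightarrow> brandt_elt) \<Rightarrow> (brandt_elt \<Rightarrow> brandt_elt) \<Rightarrow> brandt_elt \<Rightarrow> brandt_elt" where
  "brandt_End_mult n f g = compose (brandt n) g f"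

end

theory Submission
  imports Defs "HOL-Combinatorics.Permutations"
begin

text \<open>
  The large rank of a finite semigroup exceeds by one the size of a largest proper subsemigroup.
  It therefore equals the order of the semigroup as soon as some single element can be removed
  without destroying closure (\<open>large_rank_eq_card\<close>).

  An endomorphism \<open>f\<close> of \<open>B\<^sub>n\<close> sends the zero \<open>\<vartheta>\<close> to an idempotent. If that
  idempotent is some \<open>(k,k)\<close>, it absorbs every value of \<open>f\<close>, which forces \<open>f\<close> to be constant. If it
  is \<open>\<vartheta>\<close>, then either one pair, hence every pair, is sent to \<open>\<vartheta>\<close>, because any pair is a
  factor of any other; or no pair is, and then \<open>f\<close> acts on indices by an injection of \<open>[n]\<close>, that
  is, by a permutation. So \<open>End(B\<^sub>n)\<close> consists of \<open>n!\<close> automorphisms and of \<open>n + 1\<close>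
  constants, one for each idempotent (\<open>brandt_End_eq\<close>).

  The element to remove is the constant \<open>\<vartheta>\<close>. If \<open>fg\<close> is this constant, then \<open>g\<close> is either
  constant, with value \<open>\<vartheta>\<close>, or an automorphism, in which case \<open>f\<close> only takes the
  value \<open>\<vartheta>\<close>. A product of two other endomorphisms is thus never the constant \<open>\<vartheta>\<close>.
\<close>

text \<open>The set \<open>S - {x}\<close> is a subsemigroup that contains non-generating sets of every size
  below \<open>card S\<close>, so no such size can qualify.\<close>

lemma large_rank_eq_card:
  assumes "finite S" and S: "subsemigroup S m S"
    and "x \<in> S" and T: "subsemigroup S m (S - {x})"
  shows "large_rank S m = card S"
  unfolding large_rank_def
proof (rule Least_equality)
  show "\<forall>U. U \<subseteq> S \<and> finite U \<and> card U = card S \<longrightarrow> subsemigroup_generated S m U = S"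
  proof (intro allI impI)
    fix U assume "U \<subseteq> S \<and> finite U \<and> card U = card S"
    then have "U = S"
      using \<open>finite S\<close> card_subset_eq by blast
    then show "subsemigroup_generated S m U = S"
      using S unfolding subsemigroup_generated_def by blast
  qed
next
  fix k
  assume k: "\<forall>U. U \<subseteq> S \<and> finite U \<and> card U = k \<longrightarrow> subsemigroup_generated S m U = S"
  show "card S \<le> k"
  proof (rule ccontr)
    assume "\<not> card S \<le> k"
    then have "k \<le> card (S - {x})"
      using assms by simp
    then obtain U where U: "U \<subseteq> S - {x}" "card U = k" "finite U"
      by (rule obtain_subset_with_card_n)
    then have "subsemigroup_generated S m U = S"
      using k by blast
    moreover have "subsemigroup_generated S m U \<subseteq> S - {x}"
      using T U(1) unfolding subsemigroup_generated_def by blast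
    ultimately show False
      using \<open>x \<in> S\<close> by blast
  qed
qed

definition brandt_aut :: "nat \<Rightarrow> (nat \<Rightarrow> nat) \<Rightarrow> brandt_elt \<Rightarrow> brandt_elt" where
  "brandt_aut n p = (\<lambda>a\<in>brandt n. case a of Elt i j \<Rightarrow> Elt (p i) (p j) | Theta \<Rightarrow> Theta)"

definition brandt_const :: "nat \<Rightarrow> brandt_elt \<Rightarrow> brandt_elt \<Rightarrow> brandt_elt" where
  "brandt_const n c = (\<lambda>a\<in>brandt n. c)"

definition brandt_idempotents :: "nat \<Rightarrow> brandt_elt set" where
  "brandt_idempotents n = {a \<in> brandt n. brandt_add a a = a}"

lemma Theta_in_brandt [simp]: "Theta \<in> brandt n"
  by (simp add: brandt_def)

lemma Elt_in_brandt [simp]: "Elt i j \<in> brandt n \<longleftrightarrow> i \<in> {1..n} \<and> j \<in> {1..n}"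
  by (auto simp: brandt_def)

lemma brandt_add_Theta [simp]: "brandt_add a Theta = Theta"
  by (cases a) auto

lemma brandt_add_closed: "a \<in> brandt n \<Longrightarrow> b \<in> brandt n \<Longrightarrow> brandt_add a b \<in> brandt n"
  by (cases a; cases b) auto

lemma brandt_add_same_eq_iff: "brandt_add a a = a \<longleftrightarrow> a = Theta \<or> (\<exists>k. a = Elt k k)"
  by (cases a) auto

lemma brandt_idempotents_eq: "brandt_idempotents n = insert Theta ((\<lambda>k. Elt k k) ` {1..n})"
  by (auto simp: brandt_idempotents_def brandt_add_same_eq_iff)

lemma finite_brandt_idempotents: "finite (brandt_idempotents n)"
  by (simp add: brandt_idempotents_eq)

lemma card_brandt_idempotents: "card (brandt_idempotents n) = n + 1"
proof -
  have "card ((\<lambda>k. Elt k k) ` {1..n}) = n"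
    by (subst card_image) (auto simp: inj_on_def)
  then show ?thesis
    by (simp add: brandt_idempotents_eq image_iff)
qed

lemma brandt_End_add:
  "f \<in> brandt_End n \<Longrightarrow> a \<in> brandt n \<Longrightarrow> b \<in> brandt n \<Longrightarrow>
    f (brandt_add a b) = brandt_add (f a) (f b)"
  by (simp add: brandt_End_def)

lemma brandt_End_closed: "f \<in> brandt_End n \<Longrightarrow> a \<in> brandt n \<Longrightarrow> f a \<in> brandt n"
  by (auto simp: brandt_End_def)

lemma brandt_End_eqI:
  assumes "f \<in> brandt_End n" and "g \<in> extensional (brandt n)"
    and "\<And>a. a \<in> brandt n \<Longrightarrow> f a = g a"
  shows "f = g"
  using assms by (intro extensionalityI[of _ "brandt n"]) (auto simp: brandt_End_def PiE_def)

lemma brandt_const_in_End: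
  assumes "c \<in> brandt_idempotents n"
  shows "brandt_const n c \<in> brandt_End n"
  using assms by (auto simp: brandt_End_def brandt_const_def brandt_idempotents_def brandt_add_closed)

lemma brandt_aut_in_End:
  assumes "p permutes {1..n}"
  shows "brandt_aut n p \<in> brandt_End n"
proof -
  have range: "p i \<in> {1..n} \<longleftrightarrow> i \<in> {1..n}" for i
    by (rule permutes_in_image[OF assms])
  have inj: "p i = p j \<longleftrightarrow> i = j" for i j
    using permutes_inj[OF assms] by (auto dest: injD)
  show ?thesis
    unfolding brandt_End_def
  proof (intro CollectI conjI ballI)
    show "brandt_aut n p \<in> brandt n \<rightarrow>\<^sub>E brandt n"
    proof (rule PiE_I)
      fix a assume "a \<in> brandt n"
      then show "brandt_aut n p a \<in> brandt n"
        using range by (cases a) (simp_all add: brandt_aut_def)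
    qed (simp add: brandt_aut_def)
  next
    fix a b assume "a \<in> brandt n" "b \<in> brandt n"
    then show "brandt_aut n p (brandt_add a b) = brandt_add (brandt_aut n p a) (brandt_aut n p b)"
      using inj by (cases a; cases b) (auto simp: brandt_aut_def)
  qed
qed

lemma brandt_End_constI:
  assumes f: "f \<in> brandt_End n" and nz: "f Theta \<noteq> Theta"
  shows "f = brandt_const n (f Theta)"
proof (rule brandt_End_eqI[OF f])
  fix a assume a: "a \<in> brandt n"
  have "brandt_add (f Theta) (f Theta) = f Theta"
    using brandt_End_add[OF f, of Theta Theta] by simp
  then obtain k where k: "f Theta = Elt k k"
    using nz by (auto simp: brandt_add_same_eq_iff)
  have "brandt_add (f a) (Elt k k) = Elt k k" "brandt_add (Elt k k) (f a) = Elt k k"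
    using brandt_End_add[OF f a, of Theta] brandt_End_add[OF f _ a, of Theta] k by simp_all
  then have "f a = Elt k k"
    by (cases "f a") (auto split: if_splits)
  then show "f a = brandt_const n (f Theta) a"
    using a k by (simp add: brandt_const_def)
qed (simp add: brandt_const_def)

text \<open>The semigroup \<open>B\<^sub>n\<close> is 0-simple: \<open>(k,l) = (k,i) + (i,j) + (j,l)\<close>. Hence a
  zero-preserving endomorphism that sends one pair to \<open>\<vartheta>\<close> does so with all pairs.\<close>

lemma brandt_End_zeroI:
  assumes f: "f \<in> brandt_End n" and z: "f Theta = Theta"
    and ij: "i \<in> {1..n}" "j \<in> {1..n}" "f (Elt i j) = Theta"
  shows "f = brandt_const n Theta"
proof (rule brandt_End_eqI[OF f])
  fix a assume a: "a \<in> brandt n"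
  have "f a = Theta"
  proof (cases a)
    case (Elt k l)
    then have kl: "k \<in> {1..n}" "l \<in> {1..n}"
      using a by simp_all
    have "f (Elt k j) = Theta"
      using brandt_End_add[OF f, of "Elt k i" "Elt i j"] kl ij by simp
    then show ?thesis
      using brandt_End_add[OF f, of "Elt k j" "Elt j l"] kl ij Elt by simp
  qed (use z in simp)
  then show "f a = brandt_const n Theta a"
    using a by (simp add: brandt_const_def)
qed (simp add: brandt_const_def)

text \<open>The diagonal pairs go to diagonal pairs, being idempotent, and this defines the action on
  indices. It determines \<open>f\<close> since \<open>(i,j) = (i,i) + (i,j) + (j,j)\<close>, and it is injective since
  distinct diagonal pairs have sum \<open>\<vartheta>\<close>.\<close>

lemma brandt_End_autI:
  assumes f: "f \<in> brandt_End n" and z: "f Theta = Theta"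
    and nz: "\<And>i j. i \<in> {1..n} \<Longrightarrow> j \<in> {1..n} \<Longrightarrow> f (Elt i j) \<noteq> Theta"
  obtains p where "p permutes {1..n}" "f = brandt_aut n p"
proof -
  have "\<exists>k. f (Elt i i) = Elt k k" if "i \<in> {1..n}" for i
    using brandt_End_add[OF f, of "Elt i i" "Elt i i"] that nz[OF that that]
      brandt_add_same_eq_iff[of "f (Elt i i)"] by auto
  then obtain s where s: "\<And>i. i \<in> {1..n} \<Longrightarrow> f (Elt i i) = Elt (s i) (s i)"
    by metis
  \<comment> \<open>a permutation in the sense of \<open>permutes\<close> fixes all points outside the set\<close>
  define p where "p = (\<lambda>i. if i \<in> {1..n} then s i else i)"
  have p: "f (Elt i i) = Elt (p i) (p i)" if "i \<in> {1..n}" for i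
    using s[OF that] that by (simp add: p_def)
  have range: "p ` {1..n} \<subseteq> {1..n}"
  proof
    fix k assume "k \<in> p ` {1..n}"
    then obtain i where i: "i \<in> {1..n}" "k = p i" by blast
    have "Elt (p i) (p i) \<in> brandt n"
      using brandt_End_closed[OF f, of "Elt i i"] i(1) p[OF i(1)] by simp
    then show "k \<in> {1..n}"
      using i(2) by simp
  qed
  have inj: "inj_on p {1..n}"
  proof (rule inj_onI, rule ccontr)
    fix i j assume ij: "i \<in> {1..n}" "j \<in> {1..n}" "p i = p j" "i \<noteq> j"
    then have "f Theta = brandt_add (f (Elt i i)) (f (Elt j j))"
      using brandt_End_add[OF f, of "Elt i i" "Elt j j"] by simp
    then show False
      using ij p z by simp
  qed
  have perm: "p permutes {1..n}"
  proof (rule bij_imp_permutes)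
    show "bij_betw p {1..n} {1..n}"
      using inj range by (simp add: bij_betw_def endo_inj_surj)
    show "p i = i" if "i \<notin> {1..n}" for i
      using that by (auto simp: p_def)
  qed
  have "f = brandt_aut n p"
  proof (rule brandt_End_eqI[OF f])
    fix a assume a: "a \<in> brandt n"
    show "f a = brandt_aut n p a"
    proof (cases a)
      case (Elt i j)
      then have ij: "i \<in> {1..n}" "j \<in> {1..n}"
        using a by simp_all
      obtain k l where kl: "f (Elt i j) = Elt k l"
        using nz[OF ij] by (cases "f (Elt i j)") auto
      have "brandt_add (Elt i i) (Elt i j) = Elt i j" "brandt_add (Elt i j) (Elt j j) = Elt i j"
        by simp_all
      then have "brandt_add (Elt (p i) (p i)) (Elt k l) = Elt k l"
        and "brandt_add (Elt k l) (Elt (p j) (p j)) = Elt k l"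
        using brandt_End_add[OF f, of "Elt i i" "Elt i j"]
          brandt_End_add[OF f, of "Elt i j" "Elt j j"] ij p kl
        by (metis Elt_in_brandt)+
      then have "p i = k" "l = p j"
        by (metis brandt_add.simps(1) brandt_elt.distinct(1))+
      with kl have "f (Elt i j) = Elt (p i) (p j)"
        by simp
      then show ?thesis
        using Elt ij by (simp add: brandt_aut_def)
    qed (simp add: z brandt_aut_def)
  qed (simp add: brandt_aut_def)
  with perm show ?thesis
    by (rule that)
qed

lemma brandt_End_eq:
  "brandt_End n =
    brandt_aut n ` {p. p permutes {1..n}} \<union> brandt_const n ` brandt_idempotents n"
proof (intro subset_antisym subsetI)
  fix f assume f: "f \<in> brandt_End n"
  have idem: "f Theta \<in> brandt_idempotents n"
    using brandt_End_add[OF f, of Theta Theta] brandt_End_closed[OF f, of Theta]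
    by (simp add: brandt_idempotents_def)
  consider "f Theta \<noteq> Theta"
    | i j where "f Theta = Theta" "i \<in> {1..n}" "j \<in> {1..n}" "f (Elt i j) = Theta"
    | "f Theta = Theta" "\<And>i j. i \<in> {1..n} \<Longrightarrow> j \<in> {1..n} \<Longrightarrow> f (Elt i j) \<noteq> Theta"
    by blast
  then show "f \<in> brandt_aut n ` {p. p permutes {1..n}} \<union> brandt_const n ` brandt_idempotents n"
  proof cases
    case 1
    then show ?thesis
      using brandt_End_constI[OF f] idem by blast
  next
    case 2
    then have "f = brandt_const n (f Theta)"
      using brandt_End_zeroI[OF f] by simp
    then show ?thesis
      using idem by blast
  next
    case 3
    then show ?thesis
      using brandt_End_autI[OF f] by blast
  qed
qed (auto intro: brandt_aut_in_End brandt_const_in_End)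

lemma inj_on_brandt_aut: "inj_on (brandt_aut n) {p. p permutes {1..n}}"
proof (rule inj_onI)
  fix p q
  assume pq: "p \<in> {p. p permutes {1..n}}" "q \<in> {p. p permutes {1..n}}"
    and eq: "brandt_aut n p = brandt_aut n q"
  show "p = q"
  proof
    fix i
    show "p i = q i"
    proof (cases "i \<in> {1..n}")
      case True
      then show ?thesis
        using fun_cong[OF eq, of "Elt i i"] by (simp add: brandt_aut_def)
    next
      case False
      then show ?thesis
        using pq by (auto simp: permutes_def)
    qed
  qed
qed

lemma inj_brandt_const: "inj (brandt_const n)"
proof (rule injI)
  fix c d assume "brandt_const n c = brandt_const n d"
  from fun_cong[OF this, of Theta] show "c = d"
    by (simp add: brandt_const_def)
qed

text \<open>For \<open>n = 0\<close> the only endomorphism of \<open>{\<vartheta>}\<close> is both constant and an automorphism.\<close>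

lemma brandt_aut_neq_const:
  assumes "n \<ge> 1"
  shows "brandt_aut n p \<noteq> brandt_const n c"
proof
  assume eq: "brandt_aut n p = brandt_const n c"
  show False
    using fun_cong[OF eq, of Theta] fun_cong[OF eq, of "Elt 1 1"] assms
    by (simp add: brandt_aut_def brandt_const_def)
qed

lemma finite_brandt_End: "finite (brandt_End n)"
  by (simp add: brandt_End_eq finite_permutations finite_brandt_idempotents)

lemma card_brandt_End:
  assumes "n \<ge> 1"
  shows "card (brandt_End n) = fact n + n + 1"
proof -
  have "card (brandt_End n) =
      card (brandt_aut n ` {p. p permutes {1..n}}) + card (brandt_const n ` brandt_idempotents n)"
    unfolding brandt_End_eq
    using brandt_aut_neq_const[OF assms]
    by (intro card_Un_disjoint) (auto simp: finite_permutations finite_brandt_idempotents)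
  also have "\<dots> = fact n + (n + 1)"
  proof -
    have "card (brandt_aut n ` {p. p permutes {1..n}}) = card {p. p permutes {1..n}}"
      by (rule card_image[OF inj_on_brandt_aut])
    also have "\<dots> = fact n"
      by (rule card_permutations) simp_all
    finally show ?thesis
      by (simp add: card_image[OF inj_on_subset[OF inj_brandt_const subset_UNIV]]
          card_brandt_idempotents)
  qed
  finally show ?thesis
    by simp
qed

lemma brandt_End_mult_closed:
  assumes f: "f \<in> brandt_End n" and g: "g \<in> brandt_End n"
  shows "brandt_End_mult n f g \<in> brandt_End n"
proof -
  have "brandt_End_mult n f g \<in> brandt n \<rightarrow>\<^sub>E brandt n"
    using brandt_End_closed[OF f] brandt_End_closed[OF g]
    by (auto simp: brandt_End_mult_def compose_def)
  moreover have "brandt_End_mult n f g (brandt_add a b) =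
      brandt_add (brandt_End_mult n f g a) (brandt_End_mult n f g b)"
    if "a \<in> brandt n" "b \<in> brandt n" for a b
    using that
    by (simp add: brandt_End_mult_def compose_eq brandt_add_closed
        brandt_End_add[OF f] brandt_End_add[OF g] brandt_End_closed[OF f])
  ultimately show ?thesis
    by (simp add: brandt_End_def)
qed

lemma brandt_aut_eq_Theta_iff: "a \<in> brandt n \<Longrightarrow> brandt_aut n p a = Theta \<longleftrightarrow> a = Theta"
  by (cases a) (simp_all add: brandt_aut_def)

text \<open>Only the right factor \<open>g\<close> needs to be classified, since an automorphism \<open>g\<close> sends
  nothing but \<open>\<vartheta>\<close> to \<open>\<vartheta>\<close> and so leaves \<open>f\<close> no other value.\<close>

lemma brandt_End_mult_eq_const_Theta:
  assumes f: "f \<in> brandt_End n" and g: "g \<in> brandt_End n"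
    and eq: "brandt_End_mult n f g = brandt_const n Theta"
  shows "f = brandt_const n Theta \<or> g = brandt_const n Theta"
proof -
  have gf: "g (f a) = Theta" if "a \<in> brandt n" for a
    using fun_cong[OF eq, of a] that
    by (simp add: brandt_End_mult_def compose_eq brandt_const_def)
  consider c where "g = brandt_const n c" | p where "g = brandt_aut n p"
    using g unfolding brandt_End_eq by blast
  then show ?thesis
  proof cases
    case 1
    then have "c = Theta"
      using gf[of Theta] brandt_End_closed[OF f] by (simp add: brandt_const_def)
    then show ?thesis
      using 1 by simp
  next
    case 2
    have "f = brandt_const n Theta"
    proof (rule brandt_End_eqI[OF f])
      fix a assume a: "a \<in> brandt n"
      then have "f a = Theta"
        using gf[OF a] brandt_aut_eq_Theta_iff[OF brandt_End_closed[OF f a]] 2 by simp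
      then show "f a = brandt_const n Theta a"
        using a by (simp add: brandt_const_def)
    qed (simp add: brandt_const_def)
    then show ?thesis ..
  qed
qed

theorem theorem1p12:
  fixes n :: nat
  assumes "n \<ge> 2"
  shows "large_rank (brandt_End n) (brandt_End_mult n) = fact n + n + 1"
proof -
  have "large_rank (brandt_End n) (brandt_End_mult n) = card (brandt_End n)"
  proof (rule large_rank_eq_card)
    show "brandt_const n Theta \<in> brandt_End n"
      by (rule brandt_const_in_End) (simp add: brandt_idempotents_def)
    show "subsemigroup (brandt_End n) (brandt_End_mult n) (brandt_End n)"
      by (simp add: subsemigroup_def brandt_End_mult_closed)
    show "subsemigroup (brandt_End n) (brandt_End_mult n) (brandt_End n - {brandt_const n Theta})"
      using brandt_End_mult_eq_const_Theta
      by (auto simp: subsemigroup_def brandt_End_mult_closed)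
  qed (rule finite_brandt_End)
  also have "\<dots> = fact n + n + 1"
    using assms by (intro card_brandt_End) simp
  finally show ?thesis .
qed

end
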